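(* Let $G$ be a difference graph with Young matrix $Y$ having $h$ rows, and let $r_1,r_2,\ldots,r_h$ be the row sums of $Y$. Then $$\mathbf{a}_4(G)=\sum_{i=1}^{h-1}\sum_{j=i+1}^{h}(r_i-r_{i+1})\, i\, r_j.$$
   Context: All graphs are finite, simple and undirected. For a graph $G$ on $n$ vertices with adjacency matrix $\mathbf{A}(G)$, write $\det(\lambda I-\mathbf{A}(G))=\sum_{i=0}^n \mathbf{a}_i(G)\lambda^{n-i}$, so $\mathbf{a}_4(G)$ is the coefficient of $\lambda^{n-4}$. A difference graph with vertex bipartition $(X_1,\ldots,X_k;Y_1,\ldots,Y_k)$ is a graph whose vertex set is the disjoint union of nonempty sets $X_1,\ldots,X_k,Y_1,\ldots,Y_k$ in which $x\in X_i$ and $y\in Y_j$ are adjacent if and only if $i+j\le k+1$, with no other edges. Its Young matrix $Y$ has rows indexed by the vertices of $X$ listed as all vertices of $X_1$, then $X_2$, ..., then $X_k$, and columns indexed by the vertices of $Y$ listed as all of $Y_1$, then $Y_2$, ..., then $Y_k$; an entry is $1$ if the corresponding vertices are adjacent and $0$ otherwise (so $r_1\ge r_2\ge\cdots\ge r_h$). *)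

theory Defs
  imports "Graph_Theory.Pair_Digraph" "Jordan_Normal_Form.Char_Poly"
begin

text \<open>
  Finite simple undirected graphs are rendered by the locale \<^locale>\<open>pair_graph\<close>: a finite vertex set
  with an irreflexive, symmetric set of arcs, an edge being represented by both of its orientations.
  Matrices are indexed by natural numbers, so the adjacency matrix is taken with respect to an
  enumeration \<open>vs\<close> of the vertices.
\<close>

definition vertex_enum :: "'a pair_pre_digraph \<Rightarrow> 'a list \<Rightarrow> bool" where
  "vertex_enum G vs \<longleftrightarrow> distinct vs \<and> set vs = pverts G"

definition adjacency_matrix :: "'a pair_pre_digraph \<Rightarrow> 'a list \<Rightarrow> real mat" where
  "adjacency_matrix G vs =
     mat (length vs) (length vs) (\<lambda>(p, q). if (vs ! p, vs ! q) \<in> parcs G then 1 else 0)"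

text \<open>
  The coefficient of \<open>\<lambda>^(n - i)\<close> in \<open>det (\<lambda>I - A)\<close>, where \<open>n\<close> is the number of vertices.
  There is no such power if \<open>i > n\<close>, and the coefficient is then 0; without the case distinction the
  truncated subtraction on natural numbers would yield the constant term instead.
\<close>

definition adj_coeff :: "'a pair_pre_digraph \<Rightarrow> 'a list \<Rightarrow> nat \<Rightarrow> real" where
  "adj_coeff G vs i =
     (if i \<le> card (pverts G)
      then coeff (char_poly (adjacency_matrix G vs)) (card (pverts G) - i) else 0)"

locale difference_graph = pair_graph G for G :: "'a pair_pre_digraph" +
  fixes k :: nat and X Y :: "nat \<Rightarrow> 'a set"
  assumes k_pos: "1 \<le> k"
    and X_nonempty: "\<And>i. i \<in> {1..k} \<Longrightarrow> X i \<noteq> {}"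
    and Y_nonempty: "\<And>j. j \<in> {1..k} \<Longrightarrow> Y j \<noteq> {}"
    and X_disjoint: "\<And>i j. \<lbrakk>i \<in> {1..k}; j \<in> {1..k}; i \<noteq> j\<rbrakk> \<Longrightarrow> X i \<inter> X j = {}"
    and Y_disjoint: "\<And>i j. \<lbrakk>i \<in> {1..k}; j \<in> {1..k}; i \<noteq> j\<rbrakk> \<Longrightarrow> Y i \<inter> Y j = {}"
    and XY_disjoint: "\<And>i j. \<lbrakk>i \<in> {1..k}; j \<in> {1..k}\<rbrakk> \<Longrightarrow> X i \<inter> Y j = {}"
    and verts_eq: "pverts G = (\<Union>i\<in>{1..k}. X i) \<union> (\<Union>j\<in>{1..k}. Y j)"
    and adjacent_iff: "\<And>i j x y. \<lbrakk>i \<in> {1..k}; j \<in> {1..k}; x \<in> X i; y \<in> Y j\<rbrakk>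
           \<Longrightarrow> (x, y) \<in> parcs G \<longleftrightarrow> i + j \<le> k + 1"
    and no_other_edges: "\<And>u v. (u, v) \<in> parcs G \<Longrightarrow>
           \<exists>i\<in>{1..k}. \<exists>j\<in>{1..k}. (u \<in> X i \<and> v \<in> Y j) \<or> (u \<in> Y j \<and> v \<in> X i)"

text \<open>\<open>zs\<close> lists all elements of \<open>Z 1\<close>, then all of \<open>Z 2\<close>, ..., then all of \<open>Z k\<close>, each once;
  the order inside a single block is arbitrary.\<close>

definition block_listing :: "nat \<Rightarrow> (nat \<Rightarrow> 'a set) \<Rightarrow> 'a list \<Rightarrow> bool" where
  "block_listing k Z zs \<longleftrightarrow>
     (\<exists>bs. length bs = k \<and> (\<forall>i<k. distinct (bs ! i) \<and> set (bs ! i) = Z (i + 1)) \<and> zs = concat bs)"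

definition young_matrix :: "'a pair_pre_digraph \<Rightarrow> 'a list \<Rightarrow> 'a list \<Rightarrow> real mat" where
  "young_matrix G xs ys =
     mat (length xs) (length ys) (\<lambda>(p, q). if (xs ! p, ys ! q) \<in> parcs G then 1 else 0)"

text \<open>Matrix indices start at 0, while rows are numbered from 1 in \<open>row_sum\<close>.\<close>

definition row_sum :: "real mat \<Rightarrow> nat \<Rightarrow> real" where
  "row_sum M i = (\<Sum>q<dim_col M. M $$ (i - 1, q))"

end

(* A has eigenvalues e_1, ..., e_n over the complex numbers, and the coefficient in question is the
   elementary symmetric function of degree 4 in them. Since p_1 = tr A = 0, Newton's identities turn it
   into (p_2^2 - 2 p_4) / 8 with p_k = tr A^k. As G is bipartite with nested neighbourhoods,
   tr A^2 = 2 (sum_i r_i), and tr A^4 = 2 (sum_(i,j) r_(max i j)^2), because r_(max i j) is the number of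
   common neighbours of the i-th and j-th row vertices. An Abel summation gives the stated form. *)
theory Submission
  imports Defs "Jordan_Normal_Form.Schur_Decomposition"
begin

text \<open>Newton's identities up to degree 4. Reflecting the polynomial makes its \<open>i\<close>-th coefficient the
  elementary symmetric function of degree \<open>i\<close> up to sign, and 0 if there are fewer than \<open>i\<close> roots.\<close>

lemma coeff_reflect_poly_linear_factors:
  fixes es :: "'a::field_char_0 list"
  defines "c \<equiv> coeff (reflect_poly (\<Prod>e\<leftarrow>es. [:- e, 1:]))" and "p \<equiv> \<lambda>k. \<Sum>e\<leftarrow>es. e ^ k"
  shows "c 0 = 1" "c 1 = - p 1" "2 * c 2 = p 1 ^ 2 - p 2"
    "6 * c 3 = - (p 1 ^ 3) + 3 * p 1 * p 2 - 2 * p 3"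
    "24 * c 4 = p 1 ^ 4 - 6 * p 1 ^ 2 * p 2 + 3 * p 2 ^ 2 + 8 * p 1 * p 3 - 6 * p 4"
  unfolding c_def p_def
proof (induction es)
  case Nil
  {
    case 1 show ?case by simp
  next
    case 2 show ?case by simp
  next
    case 3 show ?case by (simp add: numeral_2_eq_2)
  next
    case 4 show ?case by (simp add: numeral_3_eq_3)
  next
    case 5 show ?case by (simp add: eval_nat_numeral)
  }
next
  case (Cons a es)
  define q where "q = reflect_poly (\<Prod>e\<leftarrow>es. [:- e, 1:])"
  define s where "s k = (\<Sum>e\<leftarrow>es. e ^ k)" for k
  \<comment> \<open>Reflection turns the factor \<open>[:- a, 1:]\<close> into
    \<open>[:1, - a:]\<close>. A new root \<open>a\<close> thus changes each coefficient by
    \<open>- a\<close> times the previous one and adds \<open>a ^ k\<close> to the k-th power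
    sum.\<close>
  have refl: "reflect_poly (\<Prod>e\<leftarrow>a # es. [:- e, 1:]) = [:1, - a:] * q"
    by (simp add: reflect_poly_mult q_def reflect_poly_pCons' monom_Suc monom_0 del: mult_pCons_left)
  have [simp]: "coeff ([:1, - a:] * q) 0 = coeff q 0"
    "coeff ([:1, - a:] * q) (Suc k) = coeff q (Suc k) - a * coeff q k" for k
    by simp_all
  have IH: "coeff q 0 = 1" "coeff q 1 = - s 1" "2 * coeff q 2 = s 1 ^ 2 - s 2"
    "6 * coeff q 3 = - (s 1 ^ 3) + 3 * s 1 * s 2 - 2 * s 3"
    "24 * coeff q 4 = s 1 ^ 4 - 6 * s 1 ^ 2 * s 2 + 3 * s 2 ^ 2 + 8 * s 1 * s 3 - 6 * s 4"
    using Cons.IH by (simp_all add: q_def s_def)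
  have step: "coeff ([:1, - a:] * q) 0 = coeff q 0"
    "coeff ([:1, - a:] * q) 1 = coeff q 1 - a * coeff q 0"
    "coeff ([:1, - a:] * q) 2 = coeff q 2 - a * coeff q 1"
    "coeff ([:1, - a:] * q) 3 = coeff q 3 - a * coeff q 2"
    "coeff ([:1, - a:] * q) 4 = coeff q 4 - a * coeff q 3"
    by (simp_all add: eval_nat_numeral del: mult_pCons_left)
  have sum: "(\<Sum>e\<leftarrow>a # es. e ^ k) = a ^ k + s k" for k
    by (simp add: s_def)
  {
    case 1 show ?case unfolding refl step IH ..
  next
    case 2 show ?case unfolding refl step sum IH by simp
  next
    \<comment> \<open>The unqualified name of the Groebner basis method is shadowed by \<open>HOL-Algebra\<close>.\<close>
    case 3 show ?case unfolding refl step sum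
      using IH(1-3) by Groebner_Basis.algebra
  next
    case 4 show ?case unfolding refl step sum
      using IH(1-4) by Groebner_Basis.algebra
  next
    case 5 show ?case unfolding refl step sum
      using IH by Groebner_Basis.algebra
  }
qed

section \<open>Traces, triangular matrices and the fourth coefficient\<close>

definition mat_trace :: "'a::comm_monoid_add mat \<Rightarrow> 'a" where
  "mat_trace A = sum_list (diag_mat A)"

lemma mat_trace_altdef: "mat_trace A = (\<Sum>i<dim_row A. A $$ (i, i))"
  by (simp add: mat_trace_def diag_mat_def interv_sum_list_conv_sum_set_nat atLeast0LessThan)

lemma mat_trace_mult:
  assumes "A \<in> carrier_mat n m" "B \<in> carrier_mat m n"
  shows "mat_trace (A * B) = (\<Sum>i<n. \<Sum>j<m. A $$ (i, j) * B $$ (j, i))"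
  using assms by (auto simp: mat_trace_altdef scalar_prod_def atLeast0LessThan intro!: sum.cong)

lemma mat_trace_comm:
  fixes A :: "'a::comm_semiring_0 mat"
  assumes "A \<in> carrier_mat n m" "B \<in> carrier_mat m n"
  shows "mat_trace (A * B) = mat_trace (B * A)"
  unfolding mat_trace_mult[OF assms] mat_trace_mult[OF assms(2,1)]
  by (subst sum.swap) (simp add: mult.commute)

lemma mat_trace_similar:
  fixes A :: "'a::comm_ring_1 mat"
  assumes "similar_mat A B"
  shows "mat_trace A = mat_trace B"
proof -
  obtain n P Q where *: "{A, B, P, Q} \<subseteq> carrier_mat n n" "Q * P = 1\<^sub>m n" "A = P * B * Q"
    using similar_matD[OF assms] by blast
  then have c: "A \<in> carrier_mat n n" "B \<in> carrier_mat n n" "P \<in> carrier_mat n n" "Q \<in> carrier_mat n n"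
    by auto
  have "mat_trace A = mat_trace (P * (B * Q))" using * c by simp
  also have "\<dots> = mat_trace (B * Q * P)" using c by (intro mat_trace_comm) auto
  also have "B * Q * P = B" using * c by simp
  finally show ?thesis .
qed

text \<open>In the sum for entry (i, j) the left factor kills all l < i and the right factor all l >
  j. Nothing survives if j < i, and only l = i survives if i = j.\<close>

lemma upper_triangular_mult:
  fixes A B :: "'a::semiring_0 mat"
  assumes "A \<in> carrier_mat n n" "B \<in> carrier_mat n n" "upper_triangular A" "upper_triangular B"
  shows "upper_triangular (A * B)"
    and "i < n \<Longrightarrow> (A * B) $$ (i, i) = A $$ (i, i) * B $$ (i, i)"
proof -
  have prod: "(A * B) $$ (i, j) = (\<Sum>l<n. A $$ (i, l) * B $$ (l, j))" if "i < n" "j < n" for i j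
    using that assms by (simp add: scalar_prod_def atLeast0LessThan)
  have zero: "A $$ (i, l) * B $$ (l, j) = 0" if "l < i \<or> j < l" "i < n" "l < n" for i j l
    using that assms by (auto simp: upper_triangular_def)
  show "upper_triangular (A * B)"
  proof
    fix i j assume "j < i" "i < dim_row (A * B)"
    then show "(A * B) $$ (i, j) = 0"
      using assms by (subst prod) (auto intro!: sum.neutral zero)
  qed
  show "(A * B) $$ (i, i) = A $$ (i, i) * B $$ (i, i)" if "i < n"
  proof -
    have "(A * B) $$ (i, i) = (\<Sum>l\<in>{i}. A $$ (i, l) * B $$ (l, i))"
      unfolding prod[OF that that] using that
      by (intro sum.mono_neutral_right) (auto intro!: zero)
    then show ?thesis by simp
  qed
qed

lemma upper_triangular_pow:
  fixes A :: "'a::semiring_1 mat"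
  assumes "A \<in> carrier_mat n n" "upper_triangular A"
  shows "upper_triangular (A ^\<^sub>m k) \<and> (\<forall>i<n. (A ^\<^sub>m k) $$ (i, i) = A $$ (i, i) ^ k)"
proof (induction k)
  case 0
  then show ?case using assms by auto
next
  case (Suc k)
  have "A ^\<^sub>m k \<in> carrier_mat n n" using assms by simp
  from upper_triangular_mult[OF this assms(1) _ assms(2)] Suc
  show ?case by (auto simp: power_commutes)
qed

text \<open>Schur triangularisation over the complex numbers puts the eigenvalues on the diagonal of
  some \<open>B\<close>, and the diagonal of \<open>B ^\<^sub>m k\<close> consists of their k-th
  powers. So the trace of \<open>A ^\<^sub>m k\<close> is the k-th power sum. With the first one
  zero, only p_2^2 and p_4 survive in the degree 4 identity, which is then divided by 3.\<close>

lemma char_poly_coeff_4_traceless: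
  fixes A :: "complex mat"
  assumes A: "A \<in> carrier_mat n n" and tr: "mat_trace A = 0"
  shows "8 * coeff (reflect_poly (char_poly A)) 4 = mat_trace (A ^\<^sub>m 2) ^ 2 - 2 * mat_trace (A ^\<^sub>m 4)"
proof -
  obtain B where B: "B \<in> carrier_mat n n" "upper_triangular B" "similar_mat A B"
    using char_poly_factorized[OF A] schur_decomposition_exists[OF A] by blast
  have trace: "mat_trace (A ^\<^sub>m k) = (\<Sum>e\<leftarrow>diag_mat B. e ^ k)" for k
  proof -
    have "similar_mat (A ^\<^sub>m k) (B ^\<^sub>m k)"
      using B(3) by (auto simp: similar_mat_def intro: similar_mat_wit_pow)
    then have "mat_trace (A ^\<^sub>m k) = mat_trace (B ^\<^sub>m k)"
      by (rule mat_trace_similar)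
    moreover have "diag_mat (B ^\<^sub>m k) = map (\<lambda>e. e ^ k) (diag_mat B)"
      using B(1) upper_triangular_pow[OF B(1,2), of k] by (auto simp: diag_mat_def)
    ultimately show ?thesis by (simp add: mat_trace_def)
  qed
  have 1: "(\<Sum>e\<leftarrow>diag_mat B. e ^ 1) = 0"
    using tr trace[of 1] A by simp
  have "char_poly A = (\<Prod>e\<leftarrow>diag_mat B. [:- e, 1:])"
    using char_poly_similar[OF B(3)] char_poly_upper_triangular[OF B(1,2)] by simp
  then have "24 * coeff (reflect_poly (char_poly A)) 4
      = 3 * mat_trace (A ^\<^sub>m 2) ^ 2 - 6 * mat_trace (A ^\<^sub>m 4)"
    using coeff_reflect_poly_linear_factors(5)[of "diag_mat B"] unfolding 1 trace by simp
  then show ?thesis by Groebner_Basis.algebra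
qed

text \<open>Traces, powers and the characteristic polynomial commute with the embedding into the
  complex numbers, and the embedding is injective.\<close>

lemma char_poly_coeff_4_traceless_real:
  fixes A :: "real mat"
  assumes A: "A \<in> carrier_mat n n" and tr: "mat_trace A = 0"
  shows "8 * coeff (reflect_poly (char_poly A)) 4 = mat_trace (A ^\<^sub>m 2) ^ 2 - 2 * mat_trace (A ^\<^sub>m 4)"
proof -
  let ?C = "map_mat complex_of_real"
  have trace: "mat_trace (?C M) = of_real (mat_trace M)" if "M \<in> carrier_mat n n" for M
    using that by (simp add: mat_trace_altdef)
  have pow: "mat_trace (?C A ^\<^sub>m k) = of_real (mat_trace (A ^\<^sub>m k))" for k
    using trace[of "A ^\<^sub>m k"] A by (simp add: of_real_hom.mat_hom_pow[OF A])
  have coeff: "coeff (reflect_poly (char_poly (?C A))) 4 = of_real (coeff (reflect_poly (char_poly A)) 4)"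
    by (simp add: of_real_hom.char_poly_hom[OF A] coeff_reflect_poly)
  have "8 * coeff (reflect_poly (char_poly (?C A))) 4
      = mat_trace (?C A ^\<^sub>m 2) ^ 2 - 2 * mat_trace (?C A ^\<^sub>m 4)"
    using A trace[OF A] tr by (intro char_poly_coeff_4_traceless) auto
  then have "of_real (8 * coeff (reflect_poly (char_poly A)) 4)
      = complex_of_real (mat_trace (A ^\<^sub>m 2) ^ 2 - 2 * mat_trace (A ^\<^sub>m 4))"
    by (simp add: pow coeff)
  then show ?thesis by (simp only: of_real_eq_iff)
qed


section \<open>Listings of vertices by blocks\<close>

lemma sorted_wrt_concat:
  assumes "\<And>b. b \<in> set bs \<Longrightarrow> sorted_wrt P b"
    and "sorted_wrt (\<lambda>b c. \<forall>x\<in>set b. \<forall>y\<in>set c. P x y) bs"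
  shows "sorted_wrt P (concat bs)"
  using assms by (induction bs) (auto simp: sorted_wrt_append)

lemma block_listing_set:
  assumes "block_listing k Z zs"
  shows "set zs = (\<Union>i\<in>{1..k}. Z i)"
proof -
  obtain bs where bs: "length bs = k" "\<And>i. i < k \<Longrightarrow> set (bs ! i) = Z (i + 1)" "zs = concat bs"
    using assms by (auto simp: block_listing_def)
  have "set bs = (!) bs ` {..<k}"
    using bs(1) by (auto simp: set_conv_nth)
  then have "set zs = (\<Union>i\<in>{..<k}. set (bs ! i))"
    by (simp add: bs(3))
  also have "\<dots> = (\<Union>i\<in>{..<k}. Z (Suc i))" using bs by simp
  also have "\<dots> = (\<Union>i\<in>Suc ` {..<k}. Z i)" by blast
  also have "Suc ` {..<k} = {1..k}" by (simp add: image_Suc_lessThan)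
  finally show ?thesis .
qed

lemma block_listing_distinct:
  assumes "block_listing k Z zs"
    and nonempty: "\<And>i. i \<in> {1..k} \<Longrightarrow> Z i \<noteq> {}"
    and disjoint: "\<And>i j. \<lbrakk>i \<in> {1..k}; j \<in> {1..k}; i \<noteq> j\<rbrakk> \<Longrightarrow> Z i \<inter> Z j = {}"
  shows "distinct zs"
proof -
  obtain bs where bs: "length bs = k" "\<And>i. i < k \<Longrightarrow> distinct (bs ! i)"
    "\<And>i. i < k \<Longrightarrow> set (bs ! i) = Z (i + 1)" "zs = concat bs"
    using assms(1) by (auto simp: block_listing_def)
  have disj: "set (bs ! i) \<inter> set (bs ! j) = {}" if "i < k" "j < k" "i \<noteq> j" for i j
    using that disjoint[of "i + 1" "j + 1"] by (simp add: bs(3))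
  have ne: "set (bs ! i) \<noteq> {}" if "i < k" for i
    using that nonempty[of "i + 1"] by (simp add: bs(3))
  \<comment> \<open>\<open>distinct_concat\<close> asks for pairwise different blocks. Disjoint
    blocks can be equal only if both are empty.\<close>
  have "distinct bs"
    unfolding distinct_conv_nth using disj ne bs(1) by (metis inf.idem)
  moreover have "set b \<inter> set c = {}" if "b \<in> set bs" "c \<in> set bs" "b \<noteq> c" for b c
    using that disj bs(1) by (metis in_set_conv_nth)
  moreover have "distinct b" if "b \<in> set bs" for b
    using that bs(1,2) by (metis in_set_conv_nth)
  ultimately show ?thesis unfolding bs(4) by (intro distinct_concat) auto
qed

text \<open>The order inside a block is arbitrary, so the premise includes i = j: within one block
  \<open>P\<close> must hold in either order. It will be applied to the nesting of
  neighbourhoods.\<close>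

lemma block_listing_sorted_wrt:
  assumes "block_listing k Z zs"
    and P: "\<And>i j z z'. \<lbrakk>1 \<le> i; i \<le> j; j \<le> k; z \<in> Z i; z' \<in> Z j\<rbrakk> \<Longrightarrow> P z z'"
  shows "sorted_wrt P zs"
proof -
  obtain bs where bs: "length bs = k" "\<And>i. i < k \<Longrightarrow> set (bs ! i) = Z (i + 1)" "zs = concat bs"
    using assms(1) by (auto simp: block_listing_def)
  have P': "P z z'" if "i \<le> j" "j < k" "z \<in> set (bs ! i)" "z' \<in> set (bs ! j)" for i j z z'
    using that P[of "i + 1" "j + 1"] by (simp add: bs(2))
  have "sorted_wrt P b" if b: "b \<in> set bs" for b
  proof -
    obtain i where i: "i < k" "b = bs ! i"
      using b bs(1) by (metis in_set_conv_nth)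
    have "P (b ! p) (b ! q)" if "p < q" "q < length b" for p q
    proof -
      have "b ! p \<in> set (bs ! i)" "b ! q \<in> set (bs ! i)"
        using that unfolding i(2)[symmetric] by simp_all
      with i(1) show ?thesis by (intro P'[of i i]) simp_all
    qed
    then show ?thesis by (simp add: sorted_wrt_iff_nth_less)
  qed
  moreover have "sorted_wrt (\<lambda>b c. \<forall>x\<in>set b. \<forall>y\<in>set c. P x y) bs"
    unfolding sorted_wrt_iff_nth_less bs(1)
    by (intro allI impI ballI, rule P') simp_all
  ultimately show ?thesis unfolding bs(3) by (rule sorted_wrt_concat)
qed

section \<open>Traces of bipartite matrices and summation identities\<close>

lemma sum_nth_distinct:
  assumes "distinct xs"
  shows "(\<Sum>i<length xs. f (xs ! i)) = sum f (set xs)"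
  using assms by (intro sum.reindex_bij_betw bij_betw_nth) auto

text \<open>For a matrix B with entries \<open>b x y\<close>, this is tr((B B^T)^2) = tr((B^T B)^2).
  Both sides expand to the same fourfold sum, over two elements of \<open>U\<close> and two of
  \<open>W\<close>.\<close>

lemma sum_power2_gram_swap:
  fixes b :: "'a \<Rightarrow> 'b \<Rightarrow> 'c::comm_semiring_1"
  shows "(\<Sum>x\<in>U. \<Sum>x'\<in>U. (\<Sum>y\<in>W. b x y * b x' y) ^ 2)
    = (\<Sum>y\<in>W. \<Sum>y'\<in>W. (\<Sum>x\<in>U. b x y * b x y') ^ 2)"
proof -
  have "(\<Sum>x\<in>U. \<Sum>x'\<in>U. (\<Sum>y\<in>W. b x y * b x' y) ^ 2)
      = (\<Sum>x\<in>U. \<Sum>x'\<in>U. \<Sum>y\<in>W. \<Sum>y'\<in>W. b x y * b x' y * (b x y' * b x' y'))"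
    by (simp add: power2_eq_square sum_product)
  also have "\<dots> = (\<Sum>x\<in>U. \<Sum>y\<in>W. \<Sum>x'\<in>U. \<Sum>y'\<in>W. b x y * b x' y * (b x y' * b x' y'))"
    by (intro sum.cong refl sum.swap)
  also have "\<dots> = (\<Sum>y\<in>W. \<Sum>x\<in>U. \<Sum>x'\<in>U. \<Sum>y'\<in>W. b x y * b x' y * (b x y' * b x' y'))"
    by (rule sum.swap)
  also have "\<dots> = (\<Sum>y\<in>W. \<Sum>x\<in>U. \<Sum>y'\<in>W. \<Sum>x'\<in>U. b x y * b x' y * (b x y' * b x' y'))"
    by (intro sum.cong refl sum.swap)
  also have "\<dots> = (\<Sum>y\<in>W. \<Sum>y'\<in>W. \<Sum>x\<in>U. \<Sum>x'\<in>U. b x y * b x' y * (b x y' * b x' y'))"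
    by (intro sum.cong refl sum.swap)
  also have "\<dots> = (\<Sum>y\<in>W. \<Sum>y'\<in>W. (\<Sum>x\<in>U. b x y * b x y') ^ 2)"
    by (simp add: power2_eq_square sum_product mult_ac)
  finally show ?thesis .
qed

text \<open>Up to the order of the vertices, A has zero diagonal blocks and off-diagonal blocks B
  and B^T. Hence A^2 has diagonal blocks B B^T and B^T B, and the two sides contribute equally to
  each trace. Entries are a function \<open>a\<close> of vertices, so \<open>vs\<close> need not
  list \<open>U\<close> before \<open>W\<close>.\<close>

lemma mat_trace_pow_bipartite:
  fixes a :: "'a \<Rightarrow> 'a \<Rightarrow> 'c::comm_semiring_1"
  assumes vs: "distinct vs" "set vs = U \<union> W" and disj: "U \<inter> W = {}"
    and sym: "\<And>u v. a u v = a v u"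
    and U: "\<And>u v. u \<in> U \<Longrightarrow> v \<in> U \<Longrightarrow> a u v = 0"
    and W: "\<And>u v. u \<in> W \<Longrightarrow> v \<in> W \<Longrightarrow> a u v = 0"
  defines "A \<equiv> mat (length vs) (length vs) (\<lambda>(p, q). a (vs ! p) (vs ! q))"
  shows "mat_trace (A ^\<^sub>m 2) = 2 * (\<Sum>u\<in>U. \<Sum>w\<in>W. a u w ^ 2)"
    and "mat_trace (A ^\<^sub>m 4) = 2 * (\<Sum>u\<in>U. \<Sum>v\<in>U. (\<Sum>w\<in>W. a u w * a v w) ^ 2)"
proof -
  \<comment> \<open>\<open>c\<close> is the square of the matrix, again as a function of vertices,
    so \<open>trace\<close> applies to it a second time and yields the fourth power.\<close>
  define c where "c u v = (\<Sum>w\<in>set vs. a u w * a w v)" for u v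
  let ?n = "length vs"
  have fin: "finite U" "finite W" using vs(2) by (metis finite_set finite_Un)+
  have split: "sum f (set vs) = sum f U + sum f W" for f :: "'a \<Rightarrow> 'c"
    unfolding vs(2) using fin disj by (rule sum.union_disjoint)
  have A_eq: "A = mat ?n ?n (\<lambda>(p, q). a (vs ! p) (vs ! q))" by (simp add: A_def)
  then have A: "A \<in> carrier_mat ?n ?n" by simp
  have A2: "A ^\<^sub>m 2 = A * A" using A by (simp add: numeral_2_eq_2)
  have AA: "A * A = mat ?n ?n (\<lambda>(p, q). c (vs ! p) (vs ! q))"
    by (rule eq_matI)
      (simp_all add: A_def c_def scalar_prod_def atLeast0LessThan flip: sum_nth_distinct[OF vs(1)])
  have A4: "A ^\<^sub>m 4 = (A * A) * (A * A)"
    using A by (simp add: eval_nat_numeral assoc_mult_mat[of _ ?n ?n _ ?n _ ?n])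
  have trace: "mat_trace (B * B) = (\<Sum>u\<in>set vs. \<Sum>v\<in>set vs. b u v * b v u)"
    if "B = mat ?n ?n (\<lambda>(p, q). b (vs ! p) (vs ! q))" for b :: "'a \<Rightarrow> 'a \<Rightarrow> 'c" and B
    using that by (subst mat_trace_mult[of _ ?n ?n])
      (simp_all flip: sum_nth_distinct[OF vs(1)])
  show "mat_trace (A ^\<^sub>m 2) = 2 * (\<Sum>u\<in>U. \<Sum>w\<in>W. a u w ^ 2)"
  proof -
    have "mat_trace (A ^\<^sub>m 2) = (\<Sum>u\<in>U. \<Sum>w\<in>W. a u w * a w u) + (\<Sum>w\<in>W. \<Sum>u\<in>U. a w u * a u w)"
      unfolding A2 trace[OF A_eq] split sum.distrib by (simp add: U W add.commute)
    also have "(\<Sum>w\<in>W. \<Sum>u\<in>U. a w u * a u w) = (\<Sum>u\<in>U. \<Sum>w\<in>W. a w u * a u w)"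
      by (rule sum.swap)
    finally show ?thesis by (simp add: sym[of _ "_ :: 'a"] power2_eq_square mult_2)
  qed
  have cs: "c v u = c u v" for u v
    unfolding c_def using sym by (simp add: mult.commute)
  have cU: "c u v = (\<Sum>w\<in>W. a u w * a v w)" if "u \<in> U" "v \<in> U" for u v
    using that U sym[of v] by (simp add: c_def split)
  have cW: "c u v = (\<Sum>w\<in>U. a w u * a w v)" if "u \<in> W" "v \<in> W" for u v
    using that W sym[of u] by (simp add: c_def split)
  \<comment> \<open>A path of length two cannot join the two sides: its middle vertex would share a
    side with one of its ends.\<close>
  have c0: "c u v = 0" "c v u = 0" if "u \<in> U" "v \<in> W" for u v
    using that U W by (simp_all add: c_def split)
  have "mat_trace (A ^\<^sub>m 4) = (\<Sum>u\<in>U. \<Sum>v\<in>U. c u v ^ 2) + (\<Sum>u\<in>W. \<Sum>v\<in>W. c u v ^ 2)"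
    unfolding A4 trace[OF AA] split sum.distrib by (simp add: c0 cs power2_eq_square)
  also have "(\<Sum>u\<in>W. \<Sum>v\<in>W. c u v ^ 2) = (\<Sum>u\<in>U. \<Sum>v\<in>U. c u v ^ 2)"
    using sum_power2_gram_swap[of a W U] by (simp add: cU cW)
  finally show "mat_trace (A ^\<^sub>m 4) = 2 * (\<Sum>u\<in>U. \<Sum>v\<in>U. (\<Sum>w\<in>W. a u w * a v w) ^ 2)"
    by (simp add: cU mult_2)
qed

text \<open>Induction on \<open>h\<close>, with S the sum of the first h values and r the new one.
  The square of the sum gains 2 S r + r^2, and 2 h + 1 new pairs have maximum h + 1, so the left
  side gains 2 (S - h r) r. On the right the new column j = h + 1 gives the same amount by Abel
  summation.\<close>

lemma sum_power2_max:
  fixes r :: "nat \<Rightarrow> 'a::comm_ring_1"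
  shows "(\<Sum>i=1..h. r i) ^ 2 - (\<Sum>i=1..h. \<Sum>j=1..h. r (max i j) ^ 2)
    = 2 * (\<Sum>i=1..h - 1. \<Sum>j=i + 1..h. (r i - r (i + 1)) * of_nat i * r j)"
proof (induction h)
  case 0
  show ?case by simp
next
  case (Suc h)
  define S where "S = (\<Sum>i=1..h. r i)"
  define d where "d i = (r i - r (i + 1)) * of_nat i" for i
  have abel: "(\<Sum>i=1..h. d i) = S - of_nat h * r (Suc h)"
    unfolding S_def d_def by (induction h) (simp_all add: algebra_simps)
  have max_sum: "(\<Sum>i=1..Suc h. \<Sum>j=1..Suc h. r (max i j) ^ 2)
      = (\<Sum>i=1..h. \<Sum>j=1..h. r (max i j) ^ 2) + of_nat (2 * h + 1) * r (Suc h) ^ 2"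
    by (simp add: sum.distrib max_def algebra_simps)
  have rhs_sum: "(\<Sum>i=1..Suc h - 1. \<Sum>j=i + 1..Suc h. d i * r j)
      = (\<Sum>i=1..h - 1. \<Sum>j=i + 1..h. d i * r j) + (S - of_nat h * r (Suc h)) * r (Suc h)"
  proof -
    have "(\<Sum>i=1..h. \<Sum>j=i + 1..Suc h. d i * r j)
        = (\<Sum>i=1..h. (\<Sum>j=i + 1..h. d i * r j) + d i * r (Suc h))"
      by (intro sum.cong) auto
    also have "\<dots> = (\<Sum>i=1..h. \<Sum>j=i + 1..h. d i * r j) + (S - of_nat h * r (Suc h)) * r (Suc h)"
      by (simp add: sum.distrib flip: sum_distrib_right abel)
    \<comment> \<open>The row i = h has an empty inner sum.\<close>
    also have "(\<Sum>i=1..h. \<Sum>j=i + 1..h. d i * r j) = (\<Sum>i=1..h - 1. \<Sum>j=i + 1..h. d i * r j)"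
      by (cases h) auto
    finally show ?thesis by simp
  qed
  have r_sum: "(\<Sum>i=1..Suc h. r i) = S + r (Suc h)" by (simp add: S_def)
  have IH: "S ^ 2 - (\<Sum>i=1..h. \<Sum>j=1..h. r (max i j) ^ 2)
      = 2 * (\<Sum>i=1..h - 1. \<Sum>j=i + 1..h. d i * r j)"
    using Suc.IH by (simp only: S_def d_def)
  \<comment> \<open>Here \<open>m\<close> stands for the double sum over maxima, kept opaque for the
    ring normalisation.\<close>
  have "(S + r (Suc h)) ^ 2 - (m + of_nat (2 * h + 1) * r (Suc h) ^ 2)
      = (S ^ 2 - m) + 2 * ((S - of_nat h * r (Suc h)) * r (Suc h))" for m
    by (simp add: power2_eq_square algebra_simps)
  then show ?case
    unfolding d_def[symmetric] r_sum max_sum rhs_sum by (simp only: IH distrib_left)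
qed

section \<open>The fourth coefficient of a difference graph\<close>

theorem theorem6p1:
  fixes G :: "'a pair_pre_digraph" and k h :: nat and X Y :: "nat \<Rightarrow> 'a set"
    and vs xs ys :: "'a list" and M :: "real mat" and r :: "nat \<Rightarrow> real"
  assumes "difference_graph G k X Y"
    and "vertex_enum G vs"
    and "block_listing k X xs" and "block_listing k Y ys"
    and "M = young_matrix G xs ys"
    and "h = dim_row M"
    and "\<And>i. i \<in> {1..h} \<Longrightarrow> r i = row_sum M i"
  shows "adj_coeff G vs 4 =
    (\<Sum>i = 1..h - 1. \<Sum>j = i + 1..h. (r i - r (i + 1)) * real i * r j)"
proof -
  interpret difference_graph G k X Y by fact
  define a :: "'a \<Rightarrow> 'a \<Rightarrow> real" where "a u v = (if (u, v) \<in> parcs G then 1 else 0)" for u v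
  let ?A = "adjacency_matrix G vs"
  have xs: "set xs = (\<Union>i\<in>{1..k}. X i)" "distinct xs"
    using block_listing_set[OF assms(3)] block_listing_distinct[OF assms(3)] X_nonempty X_disjoint
    by auto
  have ys: "set ys = (\<Union>i\<in>{1..k}. Y i)" "distinct ys"
    using block_listing_set[OF assms(4)] block_listing_distinct[OF assms(4)] Y_nonempty Y_disjoint
    by auto
  have vs: "distinct vs" "set vs = set xs \<union> set ys"
    using assms(2) verts_eq xs ys by (auto simp: vertex_enum_def)
  have disj: "set xs \<inter> set ys = {}"
    using XY_disjoint unfolding xs ys by blast
  have sym: "a u v = a v u" for u v
    unfolding a_def using arcs_symmetric by auto
  have edge: "(u \<in> set xs \<and> v \<in> set ys) \<or> (u \<in> set ys \<and> v \<in> set xs)"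
    if "(u, v) \<in> parcs G" for u v
    using no_other_edges[OF that] unfolding xs(1) ys(1) by blast
  have axx: "a u v = 0" if "u \<in> set xs" "v \<in> set xs" for u v
    using that edge[of u v] disj by (auto simp: a_def)
  have ayy: "a u v = 0" if "u \<in> set ys" "v \<in> set ys" for u v
    using that edge[of u v] disj by (auto simp: a_def)
  have A: "?A = mat (length vs) (length vs) (\<lambda>(p, q). a (vs ! p) (vs ! q))"
    by (simp add: adjacency_matrix_def a_def)
  have Ac: "?A \<in> carrier_mat (length vs) (length vs)" by (simp add: A)
  have h: "h = length xs"
    using assms(5,6) by (simp add: young_matrix_def)
  have r: "r i = (\<Sum>y\<in>set ys. a (xs ! (i - 1)) y)" if "i \<in> {1..h}" for i
    using that unfolding assms(7)[OF that] h
    by (auto simp: row_sum_def assms(5) young_matrix_def a_def simp flip: sum_nth_distinct[OF ys(2)]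
      intro!: sum.cong)
  \<comment> \<open>This passes from vertices to row numbers, which start at 1, whereas list
    positions start at 0.\<close>
  have sum_xs: "sum f (set xs) = (\<Sum>i=1..h. f (xs ! (i - 1)))" for f :: "'a \<Rightarrow> real"
    unfolding sum_nth_distinct[OF xs(2), symmetric] h
    by (rule sum.reindex_bij_witness[of _ "\<lambda>i. i - 1" Suc]) auto
  \<comment> \<open>Neighbourhoods shrink along \<open>xs\<close>: for i \<le> j, the bound j + l
    \<le> k + 1 implies i + l \<le> k + 1.\<close>
  have nested: "sorted_wrt (\<lambda>x x'. \<forall>y\<in>set ys. a x' y \<noteq> 0 \<longrightarrow> a x y \<noteq> 0) xs"
  proof (rule block_listing_sorted_wrt[OF assms(3)], intro ballI impI)
    fix i j x x' y
    assume *: "1 \<le> i" "i \<le> j" "j \<le> k" "x \<in> X i" "x' \<in> X j" "y \<in> set ys" "a x' y \<noteq> 0"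
    then obtain l where l: "l \<in> {1..k}" "y \<in> Y l" unfolding ys by blast
    have "j + l \<le> k + 1"
      using * l adjacent_iff[of j l x' y] by (auto simp: a_def split: if_splits)
    then show "a x y \<noteq> 0"
      using * l adjacent_iff[of i l x y] by (auto simp: a_def)
  qed
  \<comment> \<open>By nesting, every neighbour of the later row vertex is a neighbour of the
    earlier one, so their common neighbours number \<open>r j\<close>.\<close>
  have gram_le: "(\<Sum>y\<in>set ys. a (xs ! (i - 1)) y * a (xs ! (j - 1)) y) = r j"
    if "1 \<le> i" "i \<le> j" "j \<le> h" for i j
  proof -
    have absorb: "a (xs ! (i - 1)) y * a (xs ! (j - 1)) y = a (xs ! (j - 1)) y" if "y \<in> set ys" for y
    \<comment> \<open>\<open>sorted_wrt\<close> compares distinct positions only. For i = j the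
      claim is that entries 0 and 1 equal their squares.\<close>
    proof (cases "i = j")
      case True
      then show ?thesis by (simp add: a_def)
    next
      case False
      then have "i - 1 < j - 1" "j - 1 < length xs"
        using \<open>1 \<le> i\<close> \<open>i \<le> j\<close> \<open>j \<le> h\<close> h by auto
      from sorted_wrt_nth_less[OF nested this] that
      have "a (xs ! (j - 1)) y \<noteq> 0 \<longrightarrow> a (xs ! (i - 1)) y \<noteq> 0" by blast
      then show ?thesis by (auto simp: a_def split: if_splits)
    qed
    have "(\<Sum>y\<in>set ys. a (xs ! (i - 1)) y * a (xs ! (j - 1)) y) = (\<Sum>y\<in>set ys. a (xs ! (j - 1)) y)"
      by (rule sum.cong[OF refl absorb])
    also have "\<dots> = r j"
      using that r[of j] by simp
    finally show ?thesis .
  qed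
  have gram: "(\<Sum>y\<in>set ys. a (xs ! (i - 1)) y * a (xs ! (j - 1)) y) = r (max i j)"
    if "i \<in> {1..h}" "j \<in> {1..h}" for i j
    using that gram_le[of i j] gram_le[of j i]
    by (cases "i \<le> j") (auto simp: max_def mult.commute)
  have traces: "mat_trace (?A ^\<^sub>m 2) = 2 * (\<Sum>u\<in>set xs. \<Sum>w\<in>set ys. a u w ^ 2)"
    "mat_trace (?A ^\<^sub>m 4) = 2 * (\<Sum>u\<in>set xs. \<Sum>v\<in>set xs. (\<Sum>w\<in>set ys. a u w * a v w) ^ 2)"
    unfolding A by (intro mat_trace_pow_bipartite[OF vs disj sym]; fact axx ayy)+
  have "mat_trace ?A = 0"
  proof -
    have "a (vs ! p) (vs ! p) = 0" if "p < length vs" for p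
      using nth_mem[OF that] vs(2) axx ayy by blast
    then show ?thesis by (simp add: mat_trace_altdef A)
  qed
  have "8 * coeff (reflect_poly (char_poly ?A)) 4 = mat_trace (?A ^\<^sub>m 2) ^ 2 - 2 * mat_trace (?A ^\<^sub>m 4)"
    by (rule char_poly_coeff_4_traceless_real[OF Ac]) fact
  also have "mat_trace (?A ^\<^sub>m 2) = 2 * (\<Sum>i=1..h. r i)"
  proof -
    have "a u v ^ 2 = a u v" for u v by (simp add: a_def)
    then show ?thesis unfolding traces(1) sum_xs by (simp add: r)
  qed
  also have "mat_trace (?A ^\<^sub>m 4) = 2 * (\<Sum>i=1..h. \<Sum>j=1..h. r (max i j) ^ 2)"
    unfolding traces(2) sum_xs by (simp add: gram[unfolded One_nat_def])
  \<comment> \<open>With R the sum of the row sums and Q the double sum over maxima, the chain gives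
    (2 R)^2 - 2 (2 Q) on the right; both sides are divided by 4.\<close>
  finally have "2 * coeff (reflect_poly (char_poly ?A)) 4
      = (\<Sum>i=1..h. r i) ^ 2 - (\<Sum>i=1..h. \<Sum>j=1..h. r (max i j) ^ 2)"
    by (simp add: power2_eq_square)
  \<comment> \<open>The degree of the characteristic polynomial is the number n of vertices, so
    reflection moves index n - 4 to 4. For n < 4 both sides are 0.\<close>
  moreover have "adj_coeff G vs 4 = coeff (reflect_poly (char_poly ?A)) 4"
  proof -
    have "card (pverts G) = length vs"
      using assms(2) distinct_card unfolding vertex_enum_def by metis
    then show ?thesis
      using degree_monic_char_poly[OF Ac] by (auto simp: adj_coeff_def coeff_reflect_poly)
  qed
  ultimately show ?thesis unfolding sum_power2_max by simp
qed

end
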